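(* Let $m\ge n$, $p+q=m$, $A\in\mathbb{R}^{m\times n}$, $b\in\mathbb{R}^m$, $B\in\mathbb{R}^{s\times n}$, $d\in\mathbb{R}^s$, $y\in\mathbb{R}^n$, and let $\theta_1,\theta_2,\theta_3>0$. Put $r_y=b-Ay$. Let $\mu_{\tt ILSE}$, $\tau_0$ and $\rho$ be the normwise backward error of $y$, the constant, and the linearized estimate defined in the context. If $r_y\neq0$, then $$\mu_{\tt ILSE}\ \ge\ \frac{2\rho}{1+\sqrt{1+4\tau_0\sqrt{\theta_1^{-2}+\|y\|_2^2}\;\rho}} .$$
   Context: Background: the equality constrained indefinite least squares problem (ILSE) is $\min_x (b-Ax)^\top\Sigma_{pq}(b-Ax)$ subject to $Bx=d$, where $\Sigma_{pq}=\begin{pmatrix}I_p&0\\0&-I_q\end{pmatrix}$, $p+q=m$. The vector $y$ is regarded as a computed solution. Notation: $\|\cdot\|_F$ is the Frobenius norm, $\|\cdot\|_2$ the spectral norm of a matrix or 2-norm of a vector, $M^\dagger$ the Moore-Penrose inverse, $\mathrm{vec}(M)$ stacks the columns of $M$, $\otimes$ is the Kronecker product. Perturbation set: $S_{\tt ILSE}(y)$ is the set of all $(E,f,F,g)\in\mathbb{R}^{m\times n}\times\mathbb{R}^m\times\mathbb{R}^{s\times n}\times\mathbb{R}^s$ for which there exists $\xi\in\mathbb{R}^s$ (a vector of Lagrange multipliers) with $$(A+E)^\top\Sigma_{pq}\bigl(b+f-(A+E)y\bigr)=(B+F)^\top\xi,\qquad (B+F)y=d+g.$$ Normwise backward error: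 $$\mu_{\tt ILSE}=\inf_{(E,f,F,g)\in S_{\tt ILSE}(y)}\left\|\begin{bmatrix}E&\theta_1 f\\ \theta_2F&\theta_3 g\end{bmatrix}\right\|_F .$$ For $\xi\in\mathbb{R}^s$ let $$J(\xi)=\begin{bmatrix}I_n\otimes(r_y^\top\Sigma_{pq})-A^\top\Sigma_{pq}(y^\top\otimes I_m)&\theta_1^{-1}A^\top\Sigma_{pq}&-\theta_2^{-1}(I_n\otimes\xi^\top)&0\\0&0&\theta_2^{-1}(y^\top\otimes I_s)&-\theta_3^{-1}I_s\end{bmatrix},$$ $$\rho(\xi)=\left\|J(\xi)^\dagger\begin{bmatrix}B^\top\xi-A^\top\Sigma_{pq}r_y\\ d-By\end{bmatrix}\right\|_2,\qquad \rho=\inf_{\xi\in\mathbb{R}^s}\rho(\xi),$$ $$\tau_0=\left\|\begin{bmatrix}I_n\otimes(r_y^\top\Sigma_{pq})-A^\top\Sigma_{pq}(y^\top\otimes I_m)&\theta_1^{-1}A^\top\Sigma_{pq}&0\\0&0&-\theta_3^{-1}I_s\end{bmatrix}^\dagger\right\|_2 .$$ *)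

theory Defs
  imports "HOL-Analysis.Analysis"
begin

text \<open>
  Vectors and matrices are indexed by finite types, so \<open>m = CARD('m)\<close>, \<open>n = CARD('n)\<close> and
  \<open>s = CARD('s)\<close>. The norm on \<open>real^'n\<close> is the 2-norm, and the norm on matrices
  \<open>real^'n^'m\<close> is the Frobenius norm (lemma \<open>norm_matrix_eq_frobenius\<close> below).
  The spectral norm of a matrix \<open>M\<close> is \<open>onorm ((*v) M)\<close>.
\<close>

lemma norm_matrix_eq_frobenius:
  fixes M :: "real^'n^'m"
  shows "norm M = sqrt (\<Sum>i\<in>UNIV. \<Sum>j\<in>UNIV. (M $ i $ j)\<^sup>2)"
  by (simp add: norm_vec_def L2_set_def sum_nonneg)

text \<open>
  The row index type is linearly ordered: the first \<open>p\<close> diagonal entries are \<open>1\<close> and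
  the remaining \<open>q = CARD('m) - p\<close> ones are \<open>-1\<close>; \<open>p = 0\<close> and \<open>q = 0\<close> are allowed.
\<close>

definition Sigma_pq :: "nat \<Rightarrow> real^'m::{finite,linorder}^'m::{finite,linorder}" where
  "Sigma_pq p = (\<chi> i j. if i \<noteq> j then 0 else if card {k. k < i} < p then 1 else - 1)"

text \<open>Moore-Penrose inverse, characterised by the four Penrose equations.\<close>

definition is_pinv :: "real^'n^'m \<Rightarrow> real^'m^'n \<Rightarrow> bool" where
  "is_pinv M X \<longleftrightarrow>
     M ** X ** M = M \<and> X ** M ** X = X \<and>
     transpose (M ** X) = M ** X \<and> transpose (X ** M) = X ** M"

definition pinv :: "real^'n^'m \<Rightarrow> real^'m^'n" where
  "pinv M = (THE X. is_pinv M X)"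

lemma is_pinv_unique:
  assumes X: "is_pinv M X" and Y: "is_pinv M Y"
  shows "X = Y"
proof -
  have MX: "M ** X = M ** Y"
  proof -
    have "M ** X = transpose ((M ** Y ** M) ** X)"
      using X Y by (simp add: is_pinv_def)
    also have "\<dots> = transpose (M ** X) ** transpose (M ** Y)"
      by (simp add: matrix_transpose_mul matrix_mul_assoc)
    also have "\<dots> = (M ** X ** M) ** Y"
      using X Y by (simp add: is_pinv_def matrix_mul_assoc)
    finally show ?thesis using X by (simp add: is_pinv_def)
  qed
  have XM: "X ** M = Y ** M"
  proof -
    have "X ** M = transpose (X ** (M ** Y ** M))"
      using X Y by (simp add: is_pinv_def)
    also have "\<dots> = transpose (Y ** M) ** transpose (X ** M)"
      by (simp add: matrix_transpose_mul matrix_mul_assoc)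
    also have "\<dots> = (Y ** M) ** (X ** M)"
      using X Y by (simp add: is_pinv_def)
    also have "\<dots> = Y ** (M ** X ** M)"
      by (simp only: matrix_mul_assoc)
    also have "\<dots> = Y ** M" using X by (simp only: is_pinv_def)
    finally show ?thesis .
  qed
  have "X = (X ** M) ** X" using X by (simp add: is_pinv_def)
  also have "\<dots> = Y ** (M ** X)" by (simp add: XM matrix_mul_assoc)
  also have "\<dots> = Y" using Y by (simp add: MX is_pinv_def matrix_mul_assoc)
  finally show ?thesis .
qed

text \<open>
  Block matrices are indexed by sum types. As a matrix is a vector of rows, \<open>vcat\<close>
  stacks both matrices and column vectors.
\<close>

definition hcat :: "'a^'n^'m \<Rightarrow> 'a^'k^'m \<Rightarrow> 'a^('n + 'k)^'m" (infixr "<|>" 65) where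
  "M <|> N = (\<chi> i j. case j of Inl j \<Rightarrow> M $ i $ j | Inr j \<Rightarrow> N $ i $ j)"

definition vcat :: "'a^'m \<Rightarrow> 'a^'k \<Rightarrow> 'a^('m + 'k)" (infixr "<;>" 60) where
  "u <;> v = (\<chi> i. case i of Inl i \<Rightarrow> u $ i | Inr i \<Rightarrow> v $ i)"

text \<open>
  Kronecker product. The pair \<open>(j, l)\<close> stands for position \<open>l\<close> in the \<open>j\<close>-th block, so for
  \<open>E :: real^'n^'m\<close> the vector \<open>vec E\<close> of stacked columns has the entry \<open>E $ i $ j\<close> at
  position \<open>(j, i) :: 'n \<times> 'm\<close>.
\<close>

definition kron :: "real^'n^'m \<Rightarrow> real^'l^'k \<Rightarrow> real^('n \<times> 'l)^('m \<times> 'k)" (infixl "\<otimes>\<^sub>K" 75) where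
  "M \<otimes>\<^sub>K N = (\<chi> i j. M $ fst i $ fst j * N $ snd i $ snd j)"

text \<open>
  In a Kronecker product with a row vector (a matrix with the one-element row index type \<open>1\<close>)
  the rows are indexed by \<open>'m \<times> 1\<close> or \<open>1 \<times> 'm\<close>; these relabel them by \<open>'m\<close>.
\<close>

definition rows_l :: "'a^'c^('m \<times> 1) \<Rightarrow> 'a^'c^'m" where
  "rows_l M = (\<chi> i. M $ (i, 1))"

definition rows_r :: "'a^'c^(1 \<times> 'm) \<Rightarrow> 'a^'c^'m" where
  "rows_r M = (\<chi> i. M $ (1, i))"

definition S_ILSE ::
  "nat \<Rightarrow> real^'n^'m::{finite,linorder} \<Rightarrow> real^'m::{finite,linorder} \<Rightarrow> real^'n^'s \<Rightarrow> real^'s \<Rightarrow> real^'n \<Rightarrow>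
    ((real^'n^'m::{finite,linorder}) \<times> (real^'m::{finite,linorder}) \<times> (real^'n^'s) \<times> (real^'s)) set" where
  "S_ILSE p A b B d y =
     {(E, f, F, g).
        \<exists>\<xi>. transpose (A + E) *v (Sigma_pq p *v (b + f - (A + E) *v y)) = transpose (B + F) *v \<xi> \<and>
            (B + F) *v y = d + g}"

definition mu_ILSE ::
  "nat \<Rightarrow> real^'n^'m::{finite,linorder} \<Rightarrow> real^'m::{finite,linorder} \<Rightarrow> real^'n^'s \<Rightarrow> real^'s \<Rightarrow> real^'n \<Rightarrow>
    real \<Rightarrow> real \<Rightarrow> real \<Rightarrow> real" where
  "mu_ILSE p A b B d y \<theta>\<^sub>1 \<theta>\<^sub>2 \<theta>\<^sub>3 =
     (INF (E, f, F, g) \<in> S_ILSE p A b B d y.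
        norm ((E <|> (columnvector (\<theta>\<^sub>1 *\<^sub>R f) :: real^1^_)) <;>
              ((\<theta>\<^sub>2 *\<^sub>R F) <|> (columnvector (\<theta>\<^sub>3 *\<^sub>R g) :: real^1^_))))"

definition J11 ::
  "nat \<Rightarrow> real^'n^'m::{finite,linorder} \<Rightarrow> real^'m::{finite,linorder} \<Rightarrow> real^'n \<Rightarrow>
    real^('n \<times> 'm::{finite,linorder})^'n" where
  "J11 p A b y =
     rows_l (mat 1 \<otimes>\<^sub>K ((rowvector (b - A *v y) :: real^_^1) ** Sigma_pq p))
     - transpose A ** Sigma_pq p ** rows_r ((rowvector y :: real^_^1) \<otimes>\<^sub>K mat 1)"

definition J_ILSE ::
  "nat \<Rightarrow> real^'n^'m::{finite,linorder} \<Rightarrow> real^'m::{finite,linorder} \<Rightarrow> real^'n \<Rightarrow>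
    real \<Rightarrow> real \<Rightarrow> real \<Rightarrow> real^'s \<Rightarrow>
    real^(('n \<times> 'm::{finite,linorder}) + ('m::{finite,linorder} + (('n \<times> 's) + 's)))^('n + 's)" where
  "J_ILSE p A b y \<theta>\<^sub>1 \<theta>\<^sub>2 \<theta>\<^sub>3 \<xi> =
     (J11 p A b y
        <|> inverse \<theta>\<^sub>1 *\<^sub>R (transpose A ** Sigma_pq p)
        <|> - (inverse \<theta>\<^sub>2 *\<^sub>R rows_l (mat 1 \<otimes>\<^sub>K (rowvector \<xi> :: real^_^1)))
        <|> 0)
     <;>
     (0
        <|> 0
        <|> inverse \<theta>\<^sub>2 *\<^sub>R rows_r ((rowvector y :: real^_^1) \<otimes>\<^sub>K mat 1)
        <|> - (inverse \<theta>\<^sub>3 *\<^sub>R mat 1))"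

definition rho_at ::
  "nat \<Rightarrow> real^'n^'m::{finite,linorder} \<Rightarrow> real^'m::{finite,linorder} \<Rightarrow> real^'n^'s \<Rightarrow> real^'s \<Rightarrow> real^'n \<Rightarrow>
    real \<Rightarrow> real \<Rightarrow> real \<Rightarrow> real^'s \<Rightarrow> real" where
  "rho_at p A b B d y \<theta>\<^sub>1 \<theta>\<^sub>2 \<theta>\<^sub>3 \<xi> =
     norm (pinv (J_ILSE p A b y \<theta>\<^sub>1 \<theta>\<^sub>2 \<theta>\<^sub>3 \<xi>) *v
       ((transpose B *v \<xi> - transpose A *v (Sigma_pq p *v (b - A *v y))) <;> (d - B *v y)))"

definition rho_ILSE ::
  "nat \<Rightarrow> real^'n^'m::{finite,linorder} \<Rightarrow> real^'m::{finite,linorder} \<Rightarrow> real^'n^'s \<Rightarrow> real^'s \<Rightarrow> real^'n \<Rightarrow>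
    real \<Rightarrow> real \<Rightarrow> real \<Rightarrow> real" where
  "rho_ILSE p A b B d y \<theta>\<^sub>1 \<theta>\<^sub>2 \<theta>\<^sub>3 = (INF \<xi>. rho_at p A b B d y \<theta>\<^sub>1 \<theta>\<^sub>2 \<theta>\<^sub>3 \<xi>)"

text \<open>The type of \<open>B\<close> fixes the dimension \<open>s\<close> of the lower right block; its value is not used.\<close>

definition tau0_ILSE ::
  "nat \<Rightarrow> real^'n^'m::{finite,linorder} \<Rightarrow> real^'m::{finite,linorder} \<Rightarrow> real^'n^'s \<Rightarrow> real^'n \<Rightarrow>
    real \<Rightarrow> real \<Rightarrow> real" where
  "tau0_ILSE p A b B y \<theta>\<^sub>1 \<theta>\<^sub>3 =
     onorm ((*v) (pinv
       ((J11 p A b y <|> inverse \<theta>\<^sub>1 *\<^sub>R (transpose A ** Sigma_pq p) <|> 0)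
        <;>
        (0 <|> 0 <|> - (inverse \<theta>\<^sub>3 *\<^sub>R (mat 1 :: real^'s^'s))))))"

end

theory Submission
  imports Defs
begin

text \<open>
  Let \<open>w\<close> collect the entries of an admissible perturbation \<open>(E, f, F, g)\<close> with multiplier \<open>\<xi>\<close>,
  weighted as in \<open>\<mu>\<close>. Expanding the defining equations gives \<open>J(\<xi>) w = h(\<xi>) - (v, 0)\<close>, where
  \<open>\<rho>(\<xi>) = \<parallel>J(\<xi>)\<^sup>\<dagger> h(\<xi>)\<parallel>\<close>, with the quadratic remainder \<open>v = E\<^sup>T \<Sigma> (f - E y)\<close>. As \<open>r\<^sub>y \<noteq> 0\<close>, \<open>J(\<xi>)\<close> has full row rank, so its
  Moore-Penrose inverse yields minimum norm solutions: \<open>\<rho>(\<xi>) \<le> \<parallel>w\<parallel> + \<parallel>J(\<xi>)\<^sup>\<dagger>(v, 0)\<parallel>\<close>. A solution for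
  the matrix in \<open>\<tau>\<^sub>0\<close> with right-hand side \<open>(v, 0)\<close> has vanishing last block and so, padded
  with zeros, is a solution for \<open>J(\<xi>)\<close>. Hence \<open>\<rho> \<le> \<parallel>w\<parallel> + \<tau>\<^sub>0 \<gamma> \<parallel>w\<parallel>\<^sup>2\<close> with
  \<open>\<gamma> = sqrt (\<theta>\<^sub>1\<^sup>-\<^sup>2 + \<parallel>y\<parallel>\<^sup>2)\<close>, and solving this quadratic inequality gives the bound.
\<close>

section \<open>Moore-Penrose inverse of a matrix of full row rank\<close>

lemma is_pinv_pinv:
  assumes "is_pinv M X"
  shows "is_pinv M (pinv M)"
  unfolding pinv_def by (rule theI[of _ X]) (use assms is_pinv_unique in blast)+

lemma inner_matrix_vector_mult: "x \<bullet> (M *v z) = (transpose M *v x) \<bullet> z"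
  for M :: "real^'n^'m"
  by (simp add: dot_lmul_matrix)

text \<open>A kernel vector x has |M^T x|^2 = 0; lying in the range of \<open>M\<close>, it is then
  orthogonal to itself.\<close>

lemma invertible_mult_transpose:
  fixes M :: "real^'n^'m"
  assumes "surj ((*v) M)"
  shows "invertible (M ** transpose M)"
proof -
  have "x = 0" if "(M ** transpose M) *v x = 0" for x
  proof -
    have "(transpose M *v x) \<bullet> (transpose M *v x) = x \<bullet> ((M ** transpose M) *v x)"
      by (simp only: matrix_vector_mul_assoc[symmetric] inner_matrix_vector_mult)
    hence t: "transpose M *v x = 0" using that by simp
    obtain z where z: "x = M *v z" using assms by (metis surjD)
    have "x \<bullet> x = (transpose M *v x) \<bullet> z"
      by (subst (2) z) (rule inner_matrix_vector_mult)
    thus ?thesis using t by simp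
  qed
  thus ?thesis
    by (simp add: invertible_left_inverse matrix_left_invertible_ker)
qed

text \<open>The inverse is explicitly M^T (M M^T)^-1, from which the right-inverse property is read
  off.\<close>

lemma is_pinv_full_row_rank:
  fixes M :: "real^'n^'m"
  assumes "surj ((*v) M)"
  shows "is_pinv M (pinv M)" and "M ** pinv M = mat 1"
proof -
  obtain C where C: "M ** transpose M ** C = mat 1" "C ** (M ** transpose M) = mat 1"
    using invertible_mult_transpose[OF assms] by (auto simp: invertible_def)
  \<comment> \<open>The inverse of a symmetric matrix is symmetric; this makes M^T C M symmetric, as
    the fourth Penrose equation demands.\<close>
  have symC: "transpose C = C"
  proof -
    have "transpose C ** (M ** transpose M) = mat 1"
      by (metis C(1) matrix_transpose_mul transpose_mat transpose_transpose)
    hence "transpose C ** (M ** transpose M ** C) = C"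
      by (metis matrix_mul_assoc matrix_mul_lid)
    thus ?thesis by (simp add: C(1))
  qed
  have "is_pinv M (transpose M ** C)"
    unfolding is_pinv_def using C symC
    by (simp add: matrix_mul_assoc matrix_transpose_mul transpose_mat)
       (metis matrix_mul_assoc matrix_mul_rid)
  note X = this
  show "is_pinv M (pinv M)" by (rule is_pinv_pinv[OF X])
  hence "pinv M = transpose M ** C" using X by (rule is_pinv_unique)
  thus "M ** pinv M = mat 1" using C(1) by (simp add: matrix_mul_assoc)
qed

text \<open>\<open>pinv M ** M\<close> is a symmetric idempotent, hence a contraction: the
  pseudoinverse picks a solution of least norm.\<close>

lemma norm_pinv_le_norm_solution:
  fixes M :: "real^'n^'m"
  assumes "is_pinv M (pinv M)"
  shows "norm (pinv M *v (M *v z)) \<le> norm z"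
proof -
  define P where "P = pinv M ** M"
  have P: "P ** P = P" "transpose P = P"
    using assms by (simp_all add: P_def is_pinv_def matrix_mul_assoc)
  have "(P *v z) \<bullet> (P *v z) = z \<bullet> (P *v z)"
    by (metis P inner_matrix_vector_mult matrix_vector_mul_assoc)
  also have "\<dots> \<le> norm z * norm (P *v z)" by (rule norm_cauchy_schwarz)
  finally have "norm (P *v z) * norm (P *v z) \<le> norm z * norm (P *v z)"
    by (simp add: dot_square_norm power2_eq_square)
  hence "norm (P *v z) \<le> norm z"
    by (metis mult_le_cancel_right_pos norm_ge_zero norm_zero order.order_iff_strict zero_less_norm_iff)
  thus ?thesis by (simp add: P_def matrix_vector_mul_assoc)
qed

section \<open>Block matrices and Kronecker products\<close>

lemma uminus_matrix_vector_mult: "(- M) *v x = - (M *v x)"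
  for M :: "real^'n^'m"
  using matrix_vector_mult_diff_rdistrib[of 0 M x] by simp

lemma sum_UNIV_Plus:
  "(\<Sum>k\<in>(UNIV :: ('a::finite + 'b::finite) set). f k)
     = (\<Sum>i\<in>UNIV. f (Inl i)) + (\<Sum>j\<in>UNIV. f (Inr j))"
  by (simp add: sum.Plus flip: UNIV_Plus_UNIV)

lemma sum_UNIV_Times:
  "(\<Sum>k\<in>(UNIV :: ('a::finite \<times> 'b::finite) set). f k) = (\<Sum>i\<in>UNIV. \<Sum>j\<in>UNIV. f (i, j))"
  by (simp add: sum.cartesian_product)

lemma vcat_cases:
  fixes w :: "'a^('m::finite + 'k::finite)"
  obtains u v where "w = u <;> v"
proof
  show "w = (\<chi> i. w $ Inl i) <;> (\<chi> i. w $ Inr i)"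
    by (simp add: vcat_def vec_eq_iff split: sum.split)
qed

lemma vcat_eq_iff: "u <;> v = u' <;> v' \<longleftrightarrow> u = u' \<and> v = v'"
  by (auto simp: vcat_def vec_eq_iff split_sum_all)

lemma vcat_add: "(u <;> v) + (u' <;> v') = (u + u') <;> (v + v')"
  by (simp add: vcat_def vec_eq_iff split: sum.split)

lemma vcat_mult: "(M <;> N) *v x = (M *v x) <;> (N *v x)"
  for M :: "real^'n^'m"
  by (simp add: vcat_def vec_eq_iff matrix_vector_mult_def split: sum.split)

lemma hcat_mult: "(M <|> N) *v (u <;> v) = M *v u + N *v v"
  for M :: "real^'n^'m"
  by (simp add: hcat_def vcat_def vec_eq_iff matrix_vector_mult_def sum_UNIV_Plus)

lemma norm_vcat: "(norm (u <;> v))\<^sup>2 = (norm u)\<^sup>2 + (norm v)\<^sup>2"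
  for u :: "'a::real_normed_vector^'m"
  by (simp add: vcat_def norm_vec_def L2_set_def sum_nonneg sum_UNIV_Plus)

lemma norm_hcat: "(norm (M <|> N))\<^sup>2 = (norm M)\<^sup>2 + (norm N)\<^sup>2"
  for M :: "real^'n^'m"
  by (simp add: hcat_def norm_matrix_eq_frobenius sum_nonneg sum_UNIV_Plus sum.distrib)

lemma norm_columnvector: "norm (columnvector v :: real^1^'m) = norm v"
  by (simp add: norm_matrix_eq_frobenius columnvector_def norm_vec_def L2_set_def)

lemma norm_le_vcat: "norm u \<le> norm (u <;> v)"
  for u :: "'a::real_normed_vector^'m"
  by (rule power2_le_imp_le) (simp_all add: norm_vcat)

text \<open>The operator vec, with index pairs ordered (column, row) to fit
  \<open>kron\<close>.\<close>

definition vecm :: "real^'n^'m \<Rightarrow> real^('n \<times> 'm)" where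
  "vecm E = (\<chi> k. E $ snd k $ fst k)"

lemma norm_vecm: "norm (vecm E) = norm E"
proof -
  have "(\<Sum>k\<in>UNIV. (E $ snd k $ fst k)\<^sup>2) = (\<Sum>j\<in>UNIV. \<Sum>i\<in>UNIV. (E $ i $ j)\<^sup>2)"
    by (simp add: sum_UNIV_Times)
  also have "\<dots> = (\<Sum>i\<in>UNIV. \<Sum>j\<in>UNIV. (E $ i $ j)\<^sup>2)" by (rule sum.swap)
  finally show ?thesis
    by (simp add: vecm_def norm_matrix_eq_frobenius norm_vec_def L2_set_def)
qed

text \<open>This and the next lemma are cases of kron(C^T, A) vec(X) = vec(A X C): here A = v^T and
  C = I, there A = I and C = y.\<close>

lemma kron_mat1_rowvector_mult_vecm:
  fixes E :: "real^'n^'m"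
  shows "rows_l (mat 1 \<otimes>\<^sub>K (rowvector v :: real^'m^1)) *v vecm E = transpose E *v v"
proof -
  have "(\<Sum>j\<in>UNIV. \<Sum>l\<in>UNIV. (if i = j then 1 else 0) * v $ l * E $ l $ j)
      = (\<Sum>j\<in>UNIV. if i = j then \<Sum>l\<in>UNIV. v $ l * E $ l $ j else 0)" for i
    by (intro sum.cong refl) simp
  thus ?thesis
    by (simp add: vec_eq_iff rows_l_def kron_def mat_def rowvector_def vecm_def
        matrix_vector_mult_def transpose_def sum_UNIV_Times mult.commute[of "E $ _ $ _"]
        del: transpose_matrix_vector)
qed

lemma kron_rowvector_mat1_mult_vecm:
  fixes E :: "real^'n^'m"
  shows "rows_r ((rowvector y :: real^'n^1) \<otimes>\<^sub>K mat 1) *v vecm E = E *v y"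
proof -
  have "(\<Sum>j\<in>UNIV. \<Sum>l\<in>UNIV. y $ j * (if i = l then 1 else 0) * E $ l $ j)
      = (\<Sum>j\<in>UNIV. \<Sum>l\<in>UNIV. if i = l then y $ j * E $ l $ j else 0)" for i
    by (intro sum.cong refl) simp
  thus ?thesis
    by (simp add: vec_eq_iff rows_r_def kron_def mat_def rowvector_def vecm_def
        matrix_vector_mult_def sum_UNIV_Times mult.commute)
qed

text \<open>Cauchy-Schwarz in each row.\<close>

lemma norm_matrix_vector_mult_le: "norm (E *v x) \<le> norm E * norm x"
  for E :: "real^'n^'m"
proof -
  have "(norm (E *v x))\<^sup>2 = (\<Sum>i\<in>UNIV. (E $ i \<bullet> x)\<^sup>2)"
    by (simp add: norm_vec_def L2_set_def sum_nonneg matrix_vector_mult_def inner_vec_def)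
  also have "\<dots> \<le> (\<Sum>i\<in>UNIV. (norm (E $ i))\<^sup>2 * (norm x)\<^sup>2)"
    by (intro sum_mono) (metis Cauchy_Schwarz_ineq dot_square_norm)
  also have "\<dots> = (norm E * norm x)\<^sup>2"
    by (simp add: norm_vec_def L2_set_def sum_nonneg power_mult_distrib flip: sum_distrib_right)
  finally show ?thesis by (rule power2_le_imp_le) simp
qed

lemma norm_transpose: "norm (transpose E) = norm E"
  for E :: "real^'n^'m"
  by (simp add: norm_matrix_eq_frobenius transpose_def) (rule sum.swap)

section \<open>The matrix of signs\<close>

lemma Sigma_pq_mult: "(Sigma_pq p *v x) $ i = (if card {k. k < i} < p then x $ i else - (x $ i))"
proof -
  have "(Sigma_pq p *v x) $ i
      = (\<Sum>j\<in>UNIV. if i = j then (if card {k. k < i} < p then x $ i else - (x $ i)) else 0)"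
    unfolding matrix_vector_mult_def vec_lambda_beta Sigma_pq_def by (intro sum.cong refl) auto
  thus ?thesis by simp
qed

lemma norm_Sigma_pq: "norm (Sigma_pq p *v x) = norm x"
  unfolding norm_vec_def L2_set_def Sigma_pq_mult by (intro arg_cong[of _ _ sqrt] sum.cong) auto

lemma rowvector_Sigma_pq: "rowvector r ** Sigma_pq p = rowvector (Sigma_pq p *v r)"
proof -
  have "Sigma_pq p $ k $ j = Sigma_pq p $ j $ k" for k j :: 'a
    by (simp add: Sigma_pq_def)
  thus ?thesis
    by (simp add: vec_eq_iff rowvector_def matrix_matrix_mult_def matrix_vector_mult_def mult.commute)
qed

section \<open>The linearized equations\<close>

text \<open>These are the terms linear in \<open>E\<close> of (A+E)^T Sigma (b - (A+E) y).\<close>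

lemma J11_mult_vecm:
  "J11 p A b y *v vecm E
     = transpose E *v (Sigma_pq p *v (b - A *v y)) - transpose A *v (Sigma_pq p *v (E *v y))"
  by (simp add: J11_def matrix_vector_mult_diff_rdistrib rowvector_Sigma_pq
      kron_mat1_rowvector_mult_vecm kron_rowvector_mat1_mult_vecm flip: matrix_vector_mul_assoc)

lemmas block_mult = vcat_mult hcat_mult scaleR_matrix_vector_assoc[symmetric]
  kron_mat1_rowvector_mult_vecm kron_rowvector_mat1_mult_vecm

lemma J_ILSE_mult:
  "J_ILSE p A b y \<theta>\<^sub>1 \<theta>\<^sub>2 \<theta>\<^sub>3 \<xi> *v (z <;> f <;> vecm F <;> g)
     = (J11 p A b y *v z + inverse \<theta>\<^sub>1 *\<^sub>R (transpose A *v (Sigma_pq p *v f))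
          - inverse \<theta>\<^sub>2 *\<^sub>R (transpose F *v \<xi>))
       <;> (inverse \<theta>\<^sub>2 *\<^sub>R (F *v y) - inverse \<theta>\<^sub>3 *\<^sub>R g)"
  by (simp add: J_ILSE_def block_mult matrix_vector_mul_assoc[symmetric] algebra_simps
      uminus_matrix_vector_mult)

text \<open>J(xi) without the block column of \<open>F\<close>, hence free of xi; the spectral norm
  of its pseudoinverse is tau_0.\<close>

definition K_ILSE ::
  "nat \<Rightarrow> real^'n^'m::{finite,linorder} \<Rightarrow> real^'m::{finite,linorder} \<Rightarrow> real^'n \<Rightarrow>
    real \<Rightarrow> real \<Rightarrow> real^(('n \<times> 'm::{finite,linorder}) + ('m::{finite,linorder} + 's::finite))^('n + 's::finite)" where
  "K_ILSE p A b y \<theta>\<^sub>1 \<theta>\<^sub>3 =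
     (J11 p A b y <|> inverse \<theta>\<^sub>1 *\<^sub>R (transpose A ** Sigma_pq p) <|> 0)
     <;> (0 <|> 0 <|> - (inverse \<theta>\<^sub>3 *\<^sub>R mat 1))"

lemma K_ILSE_mult:
  "K_ILSE p A b y \<theta>\<^sub>1 \<theta>\<^sub>3 *v (z <;> f <;> g)
     = (J11 p A b y *v z + inverse \<theta>\<^sub>1 *\<^sub>R (transpose A *v (Sigma_pq p *v f)))
       <;> - (inverse \<theta>\<^sub>3 *\<^sub>R g)"
  by (simp add: K_ILSE_def block_mult matrix_vector_mul_assoc[symmetric] algebra_simps
      uminus_matrix_vector_mult)

text \<open>The first block row is onto: \<open>E = \<Sigma> r u\<^sup>T / \<parallel>r\<parallel>\<^sup>2\<close> has \<open>E\<^sup>T \<Sigma> r = u\<close>, and \<open>f = E y\<close> cancels the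
  remaining terms.\<close>

lemma surj_K_ILSE:
  fixes A :: "real^'n^'m::{finite,linorder}"
  assumes "b - A *v y \<noteq> 0" and "\<theta>\<^sub>1 > 0" and "\<theta>\<^sub>3 > 0"
  shows "surj ((*v) (K_ILSE p A b y \<theta>\<^sub>1 \<theta>\<^sub>3 :: real^_^('n + 's::finite)))"
proof (rule surjI)
  fix w :: "real^('n + 's)"
  obtain u v where w: "w = u <;> v" by (rule vcat_cases)
  define r where "r = b - A *v y"
  define \<sigma> where "\<sigma> = Sigma_pq p *v r"
  define c where "c = \<sigma> \<bullet> \<sigma>"
  define E :: "real^'n^'m::{finite,linorder}" where "E = (\<chi> i j. \<sigma> $ i * u $ j / c)"
  \<comment> \<open>As \<open>Sigma_pq p\<close> preserves norms, \<open>c\<close> is nonzero for r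
    nonzero, whereas r^T Sigma r could vanish.\<close>
  have "c = r \<bullet> r" by (simp add: c_def \<sigma>_def dot_square_norm norm_Sigma_pq)
  hence c: "c \<noteq> 0" using assms(1) by (simp add: r_def)
  have "(\<Sum>i\<in>UNIV. \<sigma> $ i * u $ j / c * \<sigma> $ i) = u $ j * c / c" for j
    unfolding times_divide_eq_left sum_divide_distrib[symmetric]
    by (simp add: c_def inner_vec_def sum_distrib_left mult_ac)
  hence "transpose E *v \<sigma> = u"
    using c by (simp add: E_def vec_eq_iff matrix_vector_mult_def transpose_def
        del: transpose_matrix_vector)
  hence "K_ILSE p A b y \<theta>\<^sub>1 \<theta>\<^sub>3 *v (vecm E <;> \<theta>\<^sub>1 *\<^sub>R (E *v y) <;> - (\<theta>\<^sub>3 *\<^sub>R v)) = w"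
    using assms(2,3) by (simp add: K_ILSE_mult J11_mult_vecm w \<sigma>_def r_def matrix_vector_mult_scaleR)
  \<comment> \<open>Choosing any preimage gives the right inverse that \<open>surjI\<close> asks
    for.\<close>
  thus "K_ILSE p A b y \<theta>\<^sub>1 \<theta>\<^sub>3 *v (SOME x. K_ILSE p A b y \<theta>\<^sub>1 \<theta>\<^sub>3 *v x = w) = w"
    by (rule someI)
qed

section \<open>Comparing J(xi) with the matrix of tau_0\<close>

lemma vecm_0 [simp]: "vecm 0 = 0"
  by (simp add: vecm_def vec_eq_iff)

text \<open>With F = 0 both terms from the additional block column disappear, whatever xi
  is.\<close>

lemma J_ILSE_mult_padded:
  assumes "K_ILSE p A b y \<theta>\<^sub>1 \<theta>\<^sub>3 *v (z <;> f <;> g) = w"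
  shows "J_ILSE p A b y \<theta>\<^sub>1 \<theta>\<^sub>2 \<theta>\<^sub>3 \<xi> *v (z <;> f <;> 0 <;> g) = w"
  using J_ILSE_mult[of p A b y \<theta>\<^sub>1 \<theta>\<^sub>2 \<theta>\<^sub>3 \<xi> z f 0 g] assms
  by (simp add: K_ILSE_mult transpose_def flip: zero_vec_def)

lemma surj_J_ILSE:
  fixes A :: "real^'n^'m::{finite,linorder}" and \<xi> :: "real^'s"
  assumes "b - A *v y \<noteq> 0" and "\<theta>\<^sub>1 > 0" and "\<theta>\<^sub>3 > 0"
  shows "surj ((*v) (J_ILSE p A b y \<theta>\<^sub>1 \<theta>\<^sub>2 \<theta>\<^sub>3 \<xi>))"
proof -
  have "\<exists>x. w = J_ILSE p A b y \<theta>\<^sub>1 \<theta>\<^sub>2 \<theta>\<^sub>3 \<xi> *v x" for w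
  proof -
    obtain x where "w = K_ILSE p A b y \<theta>\<^sub>1 \<theta>\<^sub>3 *v x"
      using surj_K_ILSE[OF assms, where 's = 's and p = p] by (metis surjD)
    thus ?thesis by (metis vcat_cases J_ILSE_mult_padded)
  qed
  thus ?thesis by (metis surjI surj_def)
qed

text \<open>A bound uniform in xi: the least-norm solution for \<open>K_ILSE\<close>, once padded,
  competes with the least-norm solution for J(xi).\<close>

lemma norm_pinv_J_ILSE_le:
  fixes A :: "real^'n^'m::{finite,linorder}" and \<xi> :: "real^'s" and B :: "real^'n^'s"
  assumes "b - A *v y \<noteq> 0" and "\<theta>\<^sub>1 > 0" and "\<theta>\<^sub>3 > 0"
  shows "norm (pinv (J_ILSE p A b y \<theta>\<^sub>1 \<theta>\<^sub>2 \<theta>\<^sub>3 \<xi>) *v (v <;> 0)) \<le> tau0_ILSE p A b B y \<theta>\<^sub>1 \<theta>\<^sub>3 * norm v"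
proof -
  define K :: "real^(('n \<times> 'm::{finite,linorder}) + ('m::{finite,linorder} + 's))^('n + 's)" where "K = K_ILSE p A b y \<theta>\<^sub>1 \<theta>\<^sub>3"
  define J where "J = J_ILSE p A b y \<theta>\<^sub>1 \<theta>\<^sub>2 \<theta>\<^sub>3 \<xi>"
  have surjK: "surj ((*v) K)" unfolding K_def by (rule surj_K_ILSE[OF assms])
  obtain z f g where zfg: "pinv K *v (v <;> 0) = z <;> f <;> g" by (metis vcat_cases)
  have "K *v (z <;> f <;> g) = v <;> 0"
    by (simp add: matrix_vector_mul_assoc is_pinv_full_row_rank(2)[OF surjK] flip: zfg)
  hence "J *v (z <;> f <;> 0 <;> g) = v <;> 0"
    unfolding J_def K_def by (rule J_ILSE_mult_padded)
  moreover have "is_pinv J (pinv J)"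
    unfolding J_def by (intro is_pinv_full_row_rank surj_J_ILSE assms)
  ultimately have "norm (pinv J *v (v <;> 0)) \<le> norm (z <;> f <;> (0 :: real^('n \<times> 's)) <;> g)"
    by (metis norm_pinv_le_norm_solution)
  also have "\<dots> = norm (pinv K *v (v <;> 0))"
    by (rule power2_eq_imp_eq) (simp_all add: zfg norm_vcat)
  also have "\<dots> \<le> onorm ((*v) (pinv K)) * norm (v <;> (0 :: real^'s))"
    by (rule onorm) (rule matrix_vector_mul_bounded_linear)
  also have "norm (v <;> (0 :: real^'s)) = norm v"
    by (rule power2_eq_imp_eq) (simp_all add: norm_vcat)
  also have "onorm ((*v) (pinv K)) = tau0_ILSE p A b B y \<theta>\<^sub>1 \<theta>\<^sub>3"
    by (simp add: tau0_ILSE_def K_def K_ILSE_def)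
  finally show ?thesis by (simp add: J_def)
qed

section \<open>Size of the quadratic remainder and the scalar inequality\<close>

lemma tau0_ILSE_nonneg: "0 \<le> tau0_ILSE p A b B y \<theta>\<^sub>1 \<theta>\<^sub>3"
  unfolding tau0_ILSE_def by (intro onorm_pos_le matrix_vector_mul_bounded_linear)

text \<open>Cauchy-Schwarz applied to \<open>f - E y = [E, \<theta>\<^sub>1 f] [- y; \<theta>\<^sub>1\<^sup>-\<^sup>1]\<close>.\<close>

lemma norm_residual_perturbation_le:
  fixes E :: "real^'n^'m"
  assumes "\<theta>\<^sub>1 > 0"
  shows "norm (f - E *v y) \<le>
    norm (E <|> (columnvector (\<theta>\<^sub>1 *\<^sub>R f) :: real^1^'m)) * sqrt ((inverse \<theta>\<^sub>1)\<^sup>2 + (norm y)\<^sup>2)"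
proof -
  define u :: "real^('n + 1)" where "u = (- y) <;> (\<chi> _. inverse \<theta>\<^sub>1)"
  have "(columnvector (\<theta>\<^sub>1 *\<^sub>R f) :: real^1^'m) *v (\<chi> _. inverse \<theta>\<^sub>1) = f"
    using assms by (simp add: vec_eq_iff matrix_vector_mult_def columnvector_def)
  hence "f - E *v y = (E <|> (columnvector (\<theta>\<^sub>1 *\<^sub>R f) :: real^1^'m)) *v u"
    by (simp add: u_def hcat_mult linear_neg)
  moreover have "norm u = sqrt ((inverse \<theta>\<^sub>1)\<^sup>2 + (norm y)\<^sup>2)"
    by (rule real_sqrt_unique[symmetric])
      (simp_all add: u_def norm_vcat, simp add: norm_vec_def L2_set_def power_inverse)
  ultimately show ?thesis using norm_matrix_vector_mult_le by metis
qed

text \<open>The lower bound is the nonnegative root of c t^2 + t = rho, rationalized so that it also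
  covers c = 0.\<close>

lemma quadratic_lower_bound:
  fixes t c \<rho> :: real
  assumes "0 \<le> t" "0 \<le> c" "0 \<le> \<rho>" and le: "\<rho> \<le> t + c * t\<^sup>2"
  shows "2 * \<rho> / (1 + sqrt (1 + 4 * c * \<rho>)) \<le> t"
proof -
  define s where "s = sqrt (1 + 4 * c * \<rho>)"
  have s: "s\<^sup>2 = 1 + 4 * c * \<rho>" "s \<ge> 1" using assms by (simp_all add: s_def)
  have "2 * \<rho> \<le> t * (1 + s)"
  proof (cases "c = 0")
    case True
    thus ?thesis using le by (simp add: s_def)
  next
    case False
    show ?thesis
    proof (rule ccontr)
      assume "\<not> 2 * \<rho> \<le> t * (1 + s)"
      \<comment> \<open>The factor 2c turns 2 rho into s^2 - 1 = (s - 1)(1 + s), so 1 + s cancels;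
        squaring 1 + 2ct < s then contradicts \<open>le\<close>.\<close>
      hence "2 * c * (t * (1 + s)) < 2 * c * (2 * \<rho>)"
        using False assms(2) by (intro mult_strict_left_mono) auto
      also have "\<dots> = (s - 1) * (1 + s)" using s(1) by (simp add: algebra_simps power2_eq_square)
      finally have "(2 * c * t) * (1 + s) < (s - 1) * (1 + s)" by (simp add: mult_ac)
      hence "1 + 2 * c * t < s" using s(2) by simp
      hence "(1 + 2 * c * t)\<^sup>2 < s\<^sup>2" using assms by (intro power_strict_mono) auto
      hence "4 * c * (t + c * t\<^sup>2) < 4 * c * \<rho>"
        using s(1) by (simp add: power2_eq_square algebra_simps)
      moreover have "4 * c * \<rho> \<le> 4 * c * (t + c * t\<^sup>2)"
        using le assms(2) by (intro mult_left_mono) auto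
      ultimately show False by simp
    qed
  qed
  hence "2 * \<rho> / (1 + s) \<le> t" using s(2) by (simp add: pos_divide_le_eq)
  thus ?thesis by (simp add: s_def)
qed

text \<open>Here \<open>\<xi>\<close> is the multiplier certifying admissibility; holding it fixed
  makes the term F^T xi linear, which is why J depends on xi.\<close>

lemma rho_at_le:
  fixes A :: "real^'n^'m::{finite,linorder}" and B F :: "real^'n^'s"
  assumes \<theta>: "\<theta>\<^sub>1 > 0" "\<theta>\<^sub>2 > 0" "\<theta>\<^sub>3 > 0" and r: "b - A *v y \<noteq> 0"
    and eq1: "transpose (A + E) *v (Sigma_pq p *v (b + f - (A + E) *v y)) = transpose (B + F) *v \<xi>"
    and eq2: "(B + F) *v y = d + g"
  defines "t \<equiv> norm ((E <|> (columnvector (\<theta>\<^sub>1 *\<^sub>R f) :: real^1^_)) <;>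
              ((\<theta>\<^sub>2 *\<^sub>R F) <|> (columnvector (\<theta>\<^sub>3 *\<^sub>R g) :: real^1^_)))"
  shows "rho_at p A b B d y \<theta>\<^sub>1 \<theta>\<^sub>2 \<theta>\<^sub>3 \<xi> \<le>
    t + tau0_ILSE p A b B y \<theta>\<^sub>1 \<theta>\<^sub>3 * sqrt ((inverse \<theta>\<^sub>1)\<^sup>2 + (norm y)\<^sup>2) * t\<^sup>2"
proof -
  define J where "J = J_ILSE p A b y \<theta>\<^sub>1 \<theta>\<^sub>2 \<theta>\<^sub>3 \<xi>"
  define h where
    "h = (transpose B *v \<xi> - transpose A *v (Sigma_pq p *v (b - A *v y))) <;> (d - B *v y)"
  define v where "v = transpose E *v (Sigma_pq p *v (f - E *v y))"
  define w where "w = vecm E <;> \<theta>\<^sub>1 *\<^sub>R f <;> vecm (\<theta>\<^sub>2 *\<^sub>R F) <;> \<theta>\<^sub>3 *\<^sub>R g"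
  define \<gamma> where "\<gamma> = sqrt ((inverse \<theta>\<^sub>1)\<^sup>2 + (norm y)\<^sup>2)"
  have transp: "transpose (M + N) = transpose M + transpose N" for M N :: "real^'x^'z"
    by (simp add: transpose_def vec_eq_iff)
  have transp': "transpose (c *\<^sub>R M) = c *\<^sub>R transpose M" for c and M :: "real^'x^'z"
    by (simp add: transpose_def vec_eq_iff)
  \<comment> \<open>The weights in \<open>w\<close> cancel the inverse weights in
    \<open>J\<close>.\<close>
  have "J *v w = (transpose E *v (Sigma_pq p *v (b - A *v y))
        - transpose A *v (Sigma_pq p *v (E *v y)) + transpose A *v (Sigma_pq p *v f)
        - transpose F *v \<xi>) <;> (F *v y - g)"
    using \<theta> by (simp add: J_def w_def J_ILSE_mult J11_mult_vecm transp' matrix_vector_mult_scaleR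
        flip: scaleR_matrix_vector_assoc)
  \<comment> \<open>The constraint (B+F) y = d + g is affine in (F, g), so the remainder has zero
    second block.\<close>
  hence h: "h = J *v w + (v <;> 0)"
    using eq1 eq2 unfolding h_def v_def
    by (simp add: vcat_add vcat_eq_iff transp algebra_simps matrix_vector_mult_diff_distrib
        matrix_vector_right_distrib matrix_vector_mult_add_rdistrib)
  have norm_w: "norm w = t"
    unfolding w_def t_def
    by (rule power2_eq_imp_eq) (simp_all add: norm_vcat norm_hcat norm_vecm norm_columnvector)
  have "norm E \<le> t"
  proof (rule power2_le_imp_le)
    show "(norm E)\<^sup>2 \<le> t\<^sup>2" by (simp add: t_def norm_vcat norm_hcat)
  qed (simp add: t_def)
  moreover have "norm (f - E *v y) \<le> t * \<gamma>"
    unfolding \<gamma>_def t_def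
    by (rule order_trans[OF norm_residual_perturbation_le[OF \<theta>(1)]])
       (intro mult_right_mono norm_le_vcat; simp)
  \<comment> \<open>Each factor is bounded linearly in \<open>t\<close>, so the remainder is of
    order t^2.\<close>
  ultimately have "norm E * norm (f - E *v y) \<le> t * (t * \<gamma>)"
    by (intro mult_mono) (auto simp: t_def)
  moreover have "norm v \<le> norm E * norm (f - E *v y)"
    unfolding v_def by (metis norm_matrix_vector_mult_le norm_transpose norm_Sigma_pq)
  ultimately have "norm v \<le> \<gamma> * t\<^sup>2" by (simp add: power2_eq_square mult_ac)
  hence v: "tau0_ILSE p A b B y \<theta>\<^sub>1 \<theta>\<^sub>3 * norm v \<le> tau0_ILSE p A b B y \<theta>\<^sub>1 \<theta>\<^sub>3 * (\<gamma> * t\<^sup>2)"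
    by (intro mult_left_mono tau0_ILSE_nonneg)
  have "rho_at p A b B d y \<theta>\<^sub>1 \<theta>\<^sub>2 \<theta>\<^sub>3 \<xi> = norm (pinv J *v (J *v w) + pinv J *v (v <;> 0))"
    unfolding rho_at_def J_def[symmetric] h_def[symmetric] h matrix_vector_right_distrib ..
  also have "\<dots> \<le> norm (pinv J *v (J *v w)) + norm (pinv J *v (v <;> 0))"
    by (rule norm_triangle_ineq)
  \<comment> \<open>\<open>w\<close> itself solves J z = J w, so it is no shorter than the
    least-norm solution.\<close>
  also have "norm (pinv J *v (J *v w)) \<le> t"
    unfolding norm_w[symmetric] J_def
    by (intro norm_pinv_le_norm_solution is_pinv_full_row_rank surj_J_ILSE r \<theta>)
  also have "norm (pinv J *v (v <;> 0)) \<le> tau0_ILSE p A b B y \<theta>\<^sub>1 \<theta>\<^sub>3 * norm v"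
    unfolding J_def by (rule norm_pinv_J_ILSE_le[OF r \<theta>(1,3)])
  also note v
  finally show ?thesis by (simp add: \<gamma>_def mult.assoc)
qed

theorem theorem2p2:
  fixes A :: "real^'n^'m::{finite,linorder}" and b :: "real^'m::{finite,linorder}"
    and B :: "real^'n^'s" and d :: "real^'s" and y :: "real^'n"
    and p q :: nat and \<theta>\<^sub>1 \<theta>\<^sub>2 \<theta>\<^sub>3 :: real
  assumes "CARD('m) \<ge> CARD('n)"
    and "p + q = CARD('m)"
    and "\<theta>\<^sub>1 > 0" and "\<theta>\<^sub>2 > 0" and "\<theta>\<^sub>3 > 0"
    and "b - A *v y \<noteq> 0"
  shows "mu_ILSE p A b B d y \<theta>\<^sub>1 \<theta>\<^sub>2 \<theta>\<^sub>3 \<ge>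
           2 * rho_ILSE p A b B d y \<theta>\<^sub>1 \<theta>\<^sub>2 \<theta>\<^sub>3 /
           (1 + sqrt (1 + 4 * tau0_ILSE p A b B y \<theta>\<^sub>1 \<theta>\<^sub>3 *
                            sqrt ((inverse \<theta>\<^sub>1)\<^sup>2 + (norm y)\<^sup>2) *
                            rho_ILSE p A b B d y \<theta>\<^sub>1 \<theta>\<^sub>2 \<theta>\<^sub>3))"
  unfolding mu_ILSE_def
proof (rule cINF_greatest)
  \<comment> \<open>Cancelling A, B and d turns both equations into 0 = 0, so the infimum is over a
    nonempty set.\<close>
  have "(- A, 0, - B, - d) \<in> S_ILSE p A b B d y"
    by (simp add: S_ILSE_def transpose_def flip: zero_vec_def)
  thus "S_ILSE p A b B d y \<noteq> {}" by blast
next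
  have nonneg: "0 \<le> rho_at p A b B d y \<theta>\<^sub>1 \<theta>\<^sub>2 \<theta>\<^sub>3 \<xi>" for \<xi> by (simp add: rho_at_def)
  have rho_nonneg: "0 \<le> rho_ILSE p A b B d y \<theta>\<^sub>1 \<theta>\<^sub>2 \<theta>\<^sub>3"
    unfolding rho_ILSE_def by (intro cINF_greatest nonneg) simp
  fix P assume "P \<in> S_ILSE p A b B d y"
  then obtain E f F g \<xi> where P: "P = (E, f, F, g)"
    and eqs: "transpose (A + E) *v (Sigma_pq p *v (b + f - (A + E) *v y)) = transpose (B + F) *v \<xi>"
      "(B + F) *v y = d + g"
    by (cases P) (auto simp: S_ILSE_def)
  \<comment> \<open>The multiplier varies with \<open>P\<close>; the infimum over all xi gives one
    bound for every \<open>P\<close>.\<close>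
  have "rho_ILSE p A b B d y \<theta>\<^sub>1 \<theta>\<^sub>2 \<theta>\<^sub>3 \<le> rho_at p A b B d y \<theta>\<^sub>1 \<theta>\<^sub>2 \<theta>\<^sub>3 \<xi>"
    unfolding rho_ILSE_def by (rule cINF_lower) (use nonneg in \<open>auto intro!: bdd_belowI2\<close>)
  note bound = order_trans[OF this rho_at_le[OF assms(3-6) eqs]]
  show "2 * rho_ILSE p A b B d y \<theta>\<^sub>1 \<theta>\<^sub>2 \<theta>\<^sub>3 /
           (1 + sqrt (1 + 4 * tau0_ILSE p A b B y \<theta>\<^sub>1 \<theta>\<^sub>3 *
                            sqrt ((inverse \<theta>\<^sub>1)\<^sup>2 + (norm y)\<^sup>2) *
                            rho_ILSE p A b B d y \<theta>\<^sub>1 \<theta>\<^sub>2 \<theta>\<^sub>3))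
        \<le> (case P of (E, f, F, g) \<Rightarrow>
            norm ((E <|> (columnvector (\<theta>\<^sub>1 *\<^sub>R f) :: real^1^_)) <;>
              ((\<theta>\<^sub>2 *\<^sub>R F) <|> (columnvector (\<theta>\<^sub>3 *\<^sub>R g) :: real^1^_))))"
    \<comment> \<open>Here t is the weighted norm of \<open>P\<close> and c = tau_0 sqrt(theta_1^-2
      + |y|^2).\<close>
    using quadratic_lower_bound[OF _ _ rho_nonneg bound] tau0_ILSE_nonneg[of p A b B y \<theta>\<^sub>1 \<theta>\<^sub>3]
    by (simp add: P mult.assoc)
qed

end
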